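(* Let $(K,v)$ be a valued field with value group $\Gamma_v$, and let $\Lambda$ be a totally ordered abelian group containing the divisible hull $\Gamma_{\mathbb{Q}}=\Gamma_v\otimes_{\mathbb{Z}}\mathbb{Q}$. Assume that $\Lambda$ is densely ordered. Then the weak tree topology on $\mathcal{T}=\mathcal{T}(v,\Lambda)$ coincides with the topology generated by $\bigcup_{\mu\in\mathcal{T}}\mathfrak{S}_{\mu}$, where $\mathfrak{S}_\mu$ is the Scott topology of the partially ordered set $(\mathcal{T},\leq_\mu)$.
   Context: A valuation on a commutative unital ring $R$ with values in a totally ordered abelian group $\Lambda$ is a map $\nu:R\to\Lambda_\infty=\Lambda\cup\{\infty\}$ with $\nu(ab)=\nu(a)+\nu(b)$, $\nu(a+b)\geq\min\{\nu(a),\nu(b)\}$, $\nu(1)=0$, $\nu(0)=\infty$ (where $\gamma+\infty=\infty$ and $\gamma<\infty$ for all $\gamma\in\Lambda$); nonzero elements may have value $\infty$. A valued field $(K,v)$ is a field $K$ with a valuation $v$; $\Gamma_v=v(K\setminus\{0\})$. $\Lambda$ is densely ordered if for all $\gamma<\lambda$ in $\Lambda$ there is $\alpha\in\Lambda$ with $\gamma<\alpha<\lambda$. $\mathcal{T}(v,\Lambda)$ is the set of all valuations $\nu:K[x]\to\Lambda_\infty$ with $\nu|_K=v$, partially ordered by $\mu\leq\nu$ iff $\mu(f)\leq\nu(f)$ for all $f\in K[x]$. Known facts: each set $(-\infty,\mu]=\{\nu\in\mathcal{T}\mid\nu\leq\mu\}$ is totally ordered, and (since $\Gamma_{\mathbb{Q}}\subseteq\Lambda$)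 any two $\mu,\nu\in\mathcal{T}$ have an infimum $\mu\wedge\nu\in\mathcal{T}$. Interval: $[\mu,\nu]=\{\eta\in\mathcal{T}\mid \mu\wedge\nu\leq\eta\leq\mu \text{ or } \mu\wedge\nu\leq\eta\leq\nu\}$. For $\mu\in\mathcal{T}$, define on $\mathcal{T}\setminus\{\mu\}$ the equivalence relation $\nu\sim_\mu\eta$ iff $\mu\notin[\nu,\eta]$, and let $[\nu]_\mu$ be the class of $\nu$. The weak tree topology on $\mathcal{T}$ is the topology generated by (having as subbasis) all sets $[\nu]_\mu$, $\mu\in\mathcal{T}$, $\nu\in\mathcal{T}\setminus\{\mu\}$. For fixed $\mu\in\mathcal{T}$, the partial order $\leq_\mu$ on $\mathcal{T}$ is given by $\nu\leq_\mu\eta$ iff $\nu\in[\mu,\eta]$. Scott topology of a partially ordered set $(P,\leq)$: a directed set is a non-empty $D\subseteq P$ in which every pair of elements has an upper bound in $D$. A subset $O\subseteq P$ is Scott open if (i) it is an upper set ($x\in O$, $x\leq y$ imply $y\in O$), and (ii) for every directed set $D\subseteq P$ having a supremum (least upper bound) that lies in $O$, one has $D\cap O\neq\emptyset$. The Scott topology is the set of all Scott open sets. *)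

theory Defs
  imports "HOL-Analysis.Analysis" "HOL-Library.Lub_Glb"
    "HOL-Computational_Algebra.Polynomial"
begin

datatype 'l with_inf = Fin 'l | Infty

instantiation with_inf :: (linorder) linorder
begin

fun less_eq_with_inf :: "'a with_inf \<Rightarrow> 'a with_inf \<Rightarrow> bool" where
  "Fin a \<le> Fin b \<longleftrightarrow> a \<le> b"
| "a \<le> Infty \<longleftrightarrow> True"
| "Infty \<le> Fin b \<longleftrightarrow> False"

definition less_with_inf :: "'a with_inf \<Rightarrow> 'a with_inf \<Rightarrow> bool" where
  "a < b \<longleftrightarrow> a \<le> b \<and> \<not> b \<le> a" for a b :: "'a with_inf"

instance
proof
  fix x y z :: "'a with_inf"
  show "x < y \<longleftrightarrow> x \<le> y \<and> \<not> y \<le> x" by (rule less_with_inf_def)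
  show "x \<le> x" by (cases x) auto
  show "x \<le> y \<Longrightarrow> y \<le> z \<Longrightarrow> x \<le> z" by (cases x; cases y; cases z) auto
  show "x \<le> y \<Longrightarrow> y \<le> x \<Longrightarrow> x = y" by (cases x; cases y) auto
  show "x \<le> y \<or> y \<le> x" by (cases x; cases y) auto
qed

end

instantiation with_inf :: (comm_monoid_add) comm_monoid_add
begin

definition zero_with_inf :: "'a with_inf" where
  "0 = Fin 0"

fun plus_with_inf :: "'a with_inf \<Rightarrow> 'a with_inf \<Rightarrow> 'a with_inf" where
  "Fin a + Fin b = Fin (a + b)"
| "Infty + b = Infty"
| "a + Infty = Infty"

instance
proof
  fix x y z :: "'a with_inf"
  show "x + y + z = x + (y + z)" by (cases x; cases y; cases z) (auto simp: add.assoc)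
  show "x + y = y + x" by (cases x; cases y) (auto simp: add.commute)
  show "0 + x = x" by (cases x) (auto simp: zero_with_inf_def)
qed

end

definition valuation ::
  "('a::comm_ring_1 \<Rightarrow> 'l::linordered_ab_group_add with_inf) \<Rightarrow> bool" where
  "valuation \<nu> \<longleftrightarrow>
     (\<forall>a b. \<nu> (a * b) = \<nu> a + \<nu> b) \<and>
     (\<forall>a b. min (\<nu> a) (\<nu> b) \<le> \<nu> (a + b)) \<and>
     \<nu> 1 = 0 \<and> \<nu> 0 = Infty"

text \<open>A valuation on a field is finite on all nonzero elements, so no value of a nonzero
  element is lost by retaining only the finite ones.\<close>

definition value_group ::
  "('k::field \<Rightarrow> 'l::linordered_ab_group_add with_inf) \<Rightarrow> 'l set" where
  "value_group v = {\<gamma>. \<exists>a. a \<noteq> 0 \<and> v a = Fin \<gamma>}"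

text \<open>\<open>is_divisible_hull G H\<close>: the subgroup \<open>H\<close> of \<open>\<Lambda>\<close> is a divisible hull of its subgroup \<open>G\<close>,
  that is, \<open>H\<close> is divisible and \<open>H / G\<close> is torsion. As \<open>\<Lambda>\<close> is torsion-free, such an \<open>H\<close> is
  unique if it exists, and it is a copy of \<open>G \<otimes> \<rat>\<close> with \<open>\<gamma> \<otimes> (m / n)\<close> corresponding
  to the unique \<open>h \<in> H\<close> with \<open>n h = m \<gamma>\<close>.\<close>

definition is_divisible_hull :: "'l::linordered_ab_group_add set \<Rightarrow> 'l set \<Rightarrow> bool" where
  "is_divisible_hull G H \<longleftrightarrow>
     G \<subseteq> H \<and>
     0 \<in> H \<and> (\<forall>a\<in>H. \<forall>b\<in>H. a + b \<in> H) \<and> (\<forall>a\<in>H. - a \<in> H) \<and>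
     (\<forall>h\<in>H. \<forall>n>0. \<exists>h'\<in>H. (\<Sum>i<(n::nat). h') = h) \<and>
     (\<forall>h\<in>H. \<exists>n>0. (\<Sum>i<(n::nat). h) \<in> G)"

text \<open>The partial order on extensions is the library's pointwise order on functions.\<close>

definition extensions ::
  "('k::field \<Rightarrow> 'l::linordered_ab_group_add with_inf) \<Rightarrow> ('k poly \<Rightarrow> 'l with_inf) set" where
  "extensions v = {\<nu>. valuation \<nu> \<and> (\<forall>a. \<nu> [:a:] = v a)}"

definition val_meet ::
  "('k::field \<Rightarrow> 'l::linordered_ab_group_add with_inf) \<Rightarrow>
   ('k poly \<Rightarrow> 'l with_inf) \<Rightarrow> ('k poly \<Rightarrow> 'l with_inf) \<Rightarrow> ('k poly \<Rightarrow> 'l with_inf)" where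
  "val_meet v \<mu> \<nu> = (THE \<eta>. isGlb (extensions v) {\<mu>, \<nu>} \<eta>)"

definition interval ::
  "('k::field \<Rightarrow> 'l::linordered_ab_group_add with_inf) \<Rightarrow>
   ('k poly \<Rightarrow> 'l with_inf) \<Rightarrow> ('k poly \<Rightarrow> 'l with_inf) \<Rightarrow> ('k poly \<Rightarrow> 'l with_inf) set" where
  "interval v \<mu> \<nu> =
     {\<eta> \<in> extensions v. val_meet v \<mu> \<nu> \<le> \<eta> \<and> \<eta> \<le> \<mu> \<or> val_meet v \<mu> \<nu> \<le> \<eta> \<and> \<eta> \<le> \<nu>}"

definition tree_class ::
  "('k::field \<Rightarrow> 'l::linordered_ab_group_add with_inf) \<Rightarrow>
   ('k poly \<Rightarrow> 'l with_inf) \<Rightarrow> ('k poly \<Rightarrow> 'l with_inf) \<Rightarrow> ('k poly \<Rightarrow> 'l with_inf) set" where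
  "tree_class v \<mu> \<nu> = {\<eta> \<in> extensions v - {\<mu>}. \<mu> \<notin> interval v \<nu> \<eta>}"

definition weak_tree_topology ::
  "('k::field \<Rightarrow> 'l::linordered_ab_group_add with_inf) \<Rightarrow> ('k poly \<Rightarrow> 'l with_inf) topology" where
  "weak_tree_topology v =
     topology_generated_by
       {tree_class v \<mu> \<nu> |\<mu> \<nu>. \<mu> \<in> extensions v \<and> \<nu> \<in> extensions v - {\<mu>}}"

definition rooted_le ::
  "('k::field \<Rightarrow> 'l::linordered_ab_group_add with_inf) \<Rightarrow>
   ('k poly \<Rightarrow> 'l with_inf) \<Rightarrow> ('k poly \<Rightarrow> 'l with_inf) \<Rightarrow> ('k poly \<Rightarrow> 'l with_inf) \<Rightarrow> bool" where
  "rooted_le v \<mu> \<nu> \<eta> \<longleftrightarrow> \<nu> \<in> interval v \<mu> \<eta>"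

definition directed_in :: "'p set \<Rightarrow> ('p \<Rightarrow> 'p \<Rightarrow> bool) \<Rightarrow> 'p set \<Rightarrow> bool" where
  "directed_in P le D \<longleftrightarrow>
     D \<noteq> {} \<and> D \<subseteq> P \<and> (\<forall>x\<in>D. \<forall>y\<in>D. \<exists>z\<in>D. le x z \<and> le y z)"

definition is_supremum :: "'p set \<Rightarrow> ('p \<Rightarrow> 'p \<Rightarrow> bool) \<Rightarrow> 'p set \<Rightarrow> 'p \<Rightarrow> bool" where
  "is_supremum P le D s \<longleftrightarrow>
     s \<in> P \<and> (\<forall>x\<in>D. le x s) \<and> (\<forall>u\<in>P. (\<forall>x\<in>D. le x u) \<longrightarrow> le s u)"

definition scott_open :: "'p set \<Rightarrow> ('p \<Rightarrow> 'p \<Rightarrow> bool) \<Rightarrow> 'p set \<Rightarrow> bool" where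
  "scott_open P le U \<longleftrightarrow>
     U \<subseteq> P \<and>
     (\<forall>x\<in>U. \<forall>y\<in>P. le x y \<longrightarrow> y \<in> U) \<and>
     (\<forall>D s. directed_in P le D \<and> is_supremum P le D s \<and> s \<in> U \<longrightarrow> D \<inter> U \<noteq> {})"

definition scott_opens :: "'p set \<Rightarrow> ('p \<Rightarrow> 'p \<Rightarrow> bool) \<Rightarrow> 'p set set" where
  "scott_opens P le = {U. scott_open P le U}"

end

theory Submission
  imports Defs
begin

text \<open>
  The equality of the two topologies holds for every partial order with binary meets, at least two
  elements, and totally ordered down-sets. If \<open>U\<close> is Scott open for \<open>\<le>\<^sub>\<mu>\<close> and \<open>\<eta> \<in> U\<close> differs
  from \<open>\<mu>\<close>, let \<open>D = [\<mu>, \<eta>] - {\<eta>}\<close>. Either \<open>\<eta>\<close> is the supremum of \<open>D\<close>; then \<open>D\<close> meets \<open>U\<close> in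
  some \<open>d\<close> and \<open>[\<eta>]\<^sub>d \<subseteq> U\<close>. Or \<open>\<eta>\<close> has an immediate predecessor \<open>m\<close> for \<open>\<le>\<^sub>\<mu>\<close>; then \<open>[\<eta>]\<^sub>m\<close>
  is the set of all points above \<open>\<eta>\<close>, and so it lies in \<open>U\<close>.

  That the extensions of \<open>v\<close> form such a tree rests on polynomials \<open>\<phi>\<close> of minimal degree on which
  two valuations \<open>\<mu>, \<nu>\<close> differ, say \<open>\<mu> \<phi> < \<nu> \<phi>\<close>. The infimum of \<open>\<mu>\<close> and \<open>\<nu>\<close> sends the
  \<open>\<phi>\<close>-expansion \<open>\<Sum> a\<^sub>i \<phi>\<^sup>i\<close> to the minimum of the \<open>\<mu> a\<^sub>i + i \<mu> \<phi>\<close>. If \<open>\<mu> \<le> \<nu>\<close>, then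
  \<open>\<mu>\<close> itself is of this form, whence down-sets are chains.
\<close>

section \<open>Meet trees\<close>

locale meet_tree =
  fixes T :: "'a::order set" and meet :: "'a \<Rightarrow> 'a \<Rightarrow> 'a"
  assumes meet_in: "\<lbrakk>a \<in> T; b \<in> T\<rbrakk> \<Longrightarrow> meet a b \<in> T"
    and meet_le1: "\<lbrakk>a \<in> T; b \<in> T\<rbrakk> \<Longrightarrow> meet a b \<le> a"
    and meet_le2: "\<lbrakk>a \<in> T; b \<in> T\<rbrakk> \<Longrightarrow> meet a b \<le> b"
    and meet_greatest: "\<lbrakk>a \<in> T; b \<in> T; c \<in> T; c \<le> a; c \<le> b\<rbrakk> \<Longrightarrow> c \<le> meet a b"
    and chain: "\<lbrakk>a \<in> T; b \<in> T; c \<in> T; a \<le> c; b \<le> c\<rbrakk> \<Longrightarrow> a \<le> b \<or> b \<le> a"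
begin

section \<open>Segments, the order rooted at a point, and medians\<close>

definition seg :: "'a \<Rightarrow> 'a \<Rightarrow> 'a set" where
  "seg a b = {e \<in> T. meet a b \<le> e \<and> e \<le> a \<or> meet a b \<le> e \<and> e \<le> b}"

lemma meet_commute: "\<lbrakk>a \<in> T; b \<in> T\<rbrakk> \<Longrightarrow> meet a b = meet b a"
  by (intro antisym meet_greatest meet_in meet_le1 meet_le2)

lemma le_meet_iff: "\<lbrakk>a \<in> T; b \<in> T; c \<in> T\<rbrakk> \<Longrightarrow> c \<le> meet a b \<longleftrightarrow> c \<le> a \<and> c \<le> b"
  using meet_greatest meet_le1 meet_le2 order_trans by blast

text \<open>\<open>meet a c\<close> and \<open>meet b c\<close> both lie below \<open>c\<close>, so
  they are comparable; the smaller one lies below \<open>a\<close> and \<open>b\<close>.\<close>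

lemma meet_meet_cases:
  assumes "a \<in> T" "b \<in> T" "c \<in> T"
  shows "meet a c \<le> meet a b \<or> meet b c \<le> meet a b"
proof -
  have "meet a c \<le> meet b c \<or> meet b c \<le> meet a c"
    using assms by (intro chain[of _ _ c] meet_in meet_le2)
  then show ?thesis
    using assms by (auto simp: le_meet_iff meet_in meet_le1 meet_le2)
qed

lemma seg_subset: "seg a b \<subseteq> T"
  by (auto simp: seg_def)

lemma seg_commute: "\<lbrakk>a \<in> T; b \<in> T\<rbrakk> \<Longrightarrow> seg a b = seg b a"
  by (auto simp: seg_def meet_commute)

lemma left_in_seg: "\<lbrakk>a \<in> T; b \<in> T\<rbrakk> \<Longrightarrow> a \<in> seg a b"
  by (simp add: seg_def meet_le1)

lemma right_in_seg: "\<lbrakk>a \<in> T; b \<in> T\<rbrakk> \<Longrightarrow> b \<in> seg a b"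
  by (simp add: seg_def meet_le2)

lemma seg_self: "a \<in> T \<Longrightarrow> seg a a = {a}"
  by (auto simp: seg_def meet_le1 intro: antisym order_trans[OF meet_greatest])

text \<open>Either \<open>e\<close> is above \<open>meet a c\<close>, hence on the leg from
  \<open>a\<close> to \<open>c\<close>, or \<open>e\<close> is below \<open>c\<close>. In the latter
  case \<open>meet_meet_cases\<close> forces \<open>meet c b\<close> below \<open>e\<close>, so
  \<open>e\<close> is on the other leg.\<close>

lemma seg_tripod_aux:
  assumes "a \<in> T" "b \<in> T" "c \<in> T" "e \<in> T" "meet a b \<le> e" "e \<le> a"
  shows "e \<in> seg a c \<union> seg c b"
proof (cases "meet a c \<le> e")
  case True
  then show ?thesis using assms by (simp add: seg_def)
next
  case False
  then have "e \<le> meet a c"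
    using chain[of e "meet a c" a] assms meet_in meet_le1 by blast
  then have "e \<le> c" using assms by (simp add: le_meet_iff)
  moreover have "meet c b \<le> e"
  proof (rule ccontr)
    assume *: "\<not> meet c b \<le> e"
    then have "e \<le> meet c b"
      using chain[of e "meet c b" c] \<open>e \<le> c\<close> assms meet_in meet_le1 by blast
    with * False assms show False
      using meet_meet_cases[of a b c] meet_commute[of b c] order_trans by metis
  qed
  ultimately show ?thesis using assms by (simp add: seg_def)
qed

lemma seg_tripod:
  assumes "a \<in> T" "b \<in> T" "c \<in> T"
  shows "seg a b \<subseteq> seg a c \<union> seg c b"
proof
  fix e assume e: "e \<in> seg a b"
  then consider "meet a b \<le> e" "e \<le> a" | "meet b a \<le> e" "e \<le> b"
    using assms meet_commute by (auto simp: seg_def)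
  moreover have "e \<in> T" using e by (simp add: seg_def)
  ultimately show "e \<in> seg a c \<union> seg c b"
    using seg_tripod_aux[of a b c e] seg_tripod_aux[of b a c e] assms seg_commute by cases auto
qed

text \<open>Antisymmetry of the order rooted at \<open>a\<close>: for instance,
  \<open>e \<le> a\<close> gives \<open>e \<le> meet a e \<le> b\<close>.\<close>

lemma seg_antisym:
  assumes "a \<in> T" "b \<in> T" "e \<in> seg a b" "b \<in> seg a e"
  shows "e = b"
proof -
  have e: "e \<in> T" "meet a b \<le> e" "e \<le> a \<or> e \<le> b" and b: "meet a e \<le> b" "b \<le> a \<or> b \<le> e"
    using assms by (auto simp: seg_def)
  have "e \<le> b"
    using e b assms meet_greatest[of a e e] order_trans[of e "meet a e" b] by auto
  moreover have "b \<le> e"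
    using e b assms meet_greatest[of a b b] order_trans[of b "meet a b" e] by auto
  ultimately show ?thesis by simp
qed

text \<open>Both parts come from \<open>seg_tripod\<close>, where antisymmetry collapses the
  unwanted leg to a point. The second part is proved first and used for the first.\<close>

lemma seg_trans:
  assumes "a \<in> T" "b \<in> T" "e \<in> seg a b" "f \<in> seg a e"
  shows "f \<in> seg a b" and "e \<in> seg f b"
proof -
  have T: "e \<in> T" "f \<in> T"
    using assms seg_subset by blast+
  have f_eq: "e = f" if "e \<in> seg a f"
    using seg_antisym[of a f e] that assms T by simp
  have "e \<in> seg a f \<union> seg f b"
    using seg_tripod[of a b f] assms T by blast
  then show e: "e \<in> seg f b"
    using f_eq assms T left_in_seg by auto
  have "f \<in> seg a b \<union> seg b e"
    using seg_tripod[of a e b] assms T by blast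
  moreover have "e = f" if "f \<in> seg b e"
    using seg_antisym[of b f e] seg_commute that e assms T by simp
  ultimately show "f \<in> seg a b"
    using assms by auto
qed

lemma seg_linear:
  assumes "a \<in> T" "b \<in> T" "x \<in> seg a b" "y \<in> seg a b"
  shows "x \<in> seg a y \<or> y \<in> seg a x"
proof -
  have T: "x \<in> T" "y \<in> T"
    using assms seg_subset by blast+
  have "x \<in> seg a y \<union> seg y b"
    using seg_tripod[of a b y] assms T by blast
  then show ?thesis
    using seg_trans(2)[of b a y x] assms T by (auto simp: seg_commute)
qed

lemma meet_is_median:
  assumes "a \<in> T" "b \<in> T" "c \<in> T" "meet a c \<le> meet a b" "meet b c \<le> meet a b"
  shows "meet a b \<in> seg a b \<inter> seg a c \<inter> seg b c"
  using assms by (simp add: seg_def meet_in meet_le1 meet_le2)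

text \<open>Any two of the three pairwise meets lie below a common point, hence are comparable; the
  largest of the three is a median.\<close>

lemma median_exists:
  assumes "a \<in> T" "b \<in> T" "c \<in> T"
  obtains m where "m \<in> seg a b" "m \<in> seg a c" "m \<in> seg b c"
proof -
  have "meet a b \<le> meet a c \<or> meet a c \<le> meet a b"
    using assms by (intro chain[of _ _ a] meet_in meet_le1)
  moreover have "meet a b \<le> meet b c \<or> meet b c \<le> meet a b"
    using assms by (intro chain[of _ _ b] meet_in meet_le1 meet_le2)
  moreover have "meet a c \<le> meet b c \<or> meet b c \<le> meet a c"
    using assms by (intro chain[of _ _ c] meet_in meet_le2)
  ultimately consider "meet a c \<le> meet a b" "meet b c \<le> meet a b"
    | "meet a b \<le> meet a c" "meet b c \<le> meet a c"
    | "meet a b \<le> meet b c" "meet a c \<le> meet b c"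
    by (meson order_trans)
  then show thesis
  proof cases
    case 1
    then show thesis using meet_is_median[of a b c] assms that by blast
  next
    case 2
    then show thesis using meet_is_median[of a c b] assms that by (auto simp: meet_commute seg_commute)
  next
    case 3
    then show thesis using meet_is_median[of b c a] assms that by (auto simp: meet_commute seg_commute)
  qed
qed

text \<open>Two medians are comparable on \<open>seg a b\<close>; let \<open>m\<close> come before
  \<open>n\<close>. Then \<open>n\<close> lies between \<open>m\<close> and each of
  \<open>b\<close>, \<open>c\<close>, while \<open>m\<close> lies between \<open>n\<close> and one
  of them; antisymmetry from that end gives \<open>m = n\<close>.\<close>

lemma median_unique:
  assumes T: "a \<in> T" "b \<in> T" "c \<in> T"
    and m: "m \<in> seg a b" "m \<in> seg a c" "m \<in> seg b c"
    and n: "n \<in> seg a b" "n \<in> seg a c" "n \<in> seg b c"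
  shows "m = n"
proof -
  have "m = n" if "m \<in> seg a n" and m: "m \<in> seg b c" and n: "n \<in> seg a b" "n \<in> seg a c" for m n
  proof -
    have T': "m \<in> T" "n \<in> T"
      using m n seg_subset by blast+
    have "n \<in> seg m b" "n \<in> seg m c"
      using seg_trans(2)[of a _ n m] that T by blast+
    moreover have "m \<in> seg b n \<union> seg n c"
      using seg_tripod[of b c n] T T' m by blast
    ultimately show ?thesis
      using seg_antisym[of b n m] seg_antisym[of c n m] T T' by (auto simp: seg_commute)
  qed
  from this[of m n] this[of n m] show ?thesis
    using seg_linear[of a b m n] assms by blast
qed

section \<open>Components of the tree without a point, and Scott open sets\<close>

definition component :: "'a \<Rightarrow> 'a \<Rightarrow> 'a set" where
  "component \<mu> \<nu> = {\<eta> \<in> T - {\<mu>}. \<mu> \<notin> seg \<nu> \<eta>}"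

text \<open>A component at the root is closed under going up in the rooted order, and under going
  down except to \<open>\<mu>\<close>. So a directed set with supremum in it meets it in any point
  other than \<open>\<mu>\<close>, and such a point exists because the supremum is not
  \<open>\<mu>\<close>.\<close>

lemma component_scott_open:
  assumes "\<mu> \<in> T" "\<nu> \<in> T" "\<nu> \<noteq> \<mu>"
  shows "scott_open T (\<lambda>x y. x \<in> seg \<mu> y) (component \<mu> \<nu>)"
proof -
  have up: "\<eta>' \<in> component \<mu> \<nu>"
    if "\<eta> \<in> component \<mu> \<nu>" "\<eta>' \<in> T" "\<eta> \<in> seg \<mu> \<eta>'" for \<eta> \<eta>'
  proof -
    have \<eta>: "\<eta> \<in> T" "\<eta> \<noteq> \<mu>" "\<mu> \<notin> seg \<nu> \<eta>"
      using that by (auto simp: component_def)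
    have "\<eta>' \<noteq> \<mu>"
      using that \<eta> seg_self assms by auto
    moreover have "\<mu> \<notin> seg \<eta> \<eta>'"
      using seg_antisym[of \<eta>' \<mu> \<eta>] that \<eta> assms by (auto simp: seg_commute)
    ultimately show ?thesis
      using seg_tripod[of \<nu> \<eta>' \<eta>] that \<eta> assms by (auto simp: component_def)
  qed
  have down: "d \<in> component \<mu> \<nu>"
    if s: "s \<in> component \<mu> \<nu>" and d: "d \<in> T" "d \<in> seg \<mu> s" "d \<noteq> \<mu>" for s d
  proof -
    have s: "s \<in> T" "s \<noteq> \<mu>" "\<mu> \<notin> seg \<nu> s"
      using s by (auto simp: component_def)
    moreover have "\<mu> \<notin> seg s d"
      using seg_antisym[of s \<mu> d] d s assms by (auto simp: seg_commute)
    ultimately show ?thesis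
      using seg_tripod[of \<nu> d s] d assms by (auto simp: component_def)
  qed
  have meets: "D \<inter> component \<mu> \<nu> \<noteq> {}"
    if D: "directed_in T (\<lambda>x y. x \<in> seg \<mu> y) D" and s: "is_supremum T (\<lambda>x y. x \<in> seg \<mu> y) D s"
      and "s \<in> component \<mu> \<nu>" for D s
  proof (cases "D \<subseteq> {\<mu>}")
    case True
    then have "\<forall>x\<in>D. x \<in> seg \<mu> \<mu>"
      using assms left_in_seg by auto
    then have "s \<in> seg \<mu> \<mu>"
      using s assms by (simp add: is_supremum_def)
    then show ?thesis
      using that assms by (auto simp: seg_self component_def)
  next
    case False
    then obtain d where "d \<in> D" "d \<noteq> \<mu>" by auto
    moreover have "D \<subseteq> T" "\<forall>x\<in>D. x \<in> seg \<mu> s"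
      using D s by (simp_all add: directed_in_def is_supremum_def)
    ultimately show ?thesis
      using down[OF that(3)] by blast
  qed
  show ?thesis
    unfolding scott_open_def
  proof (intro conjI)
    show "component \<mu> \<nu> \<subseteq> T" by (auto simp: component_def)
  qed (use up meets in blast)+
qed

lemma scott_open_nbhd:
  assumes "\<mu> \<in> T" and U: "scott_open T (\<lambda>x y. x \<in> seg \<mu> y) U" and "\<eta> \<in> U" "\<eta> \<noteq> \<mu>"
  obtains d where "d \<in> T" "d \<noteq> \<eta>" "\<eta> \<in> component d \<eta>" "component d \<eta> \<subseteq> U"
proof -
  have up: "y \<in> U" if "x \<in> U" "y \<in> T" "x \<in> seg \<mu> y" for x y
    using U that by (auto simp: scott_open_def)
  have \<eta>: "\<eta> \<in> T" using U assms by (auto simp: scott_open_def)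
  have self: "\<eta> \<in> component d \<eta>" if "d \<noteq> \<eta>" for d
    using that \<eta> by (auto simp: component_def seg_self)
  define D where "D = seg \<mu> \<eta> - {\<eta>}"
  have "\<mu> \<in> D"
    using assms \<eta> left_in_seg by (auto simp: D_def)
  have directed: "directed_in T (\<lambda>x y. x \<in> seg \<mu> y) D"
    unfolding directed_in_def
  proof (intro conjI ballI)
    show "D \<noteq> {}" using \<open>\<mu> \<in> D\<close> by auto
    show D_T: "D \<subseteq> T" using seg_subset by (auto simp: D_def)
    fix x y assume xy: "x \<in> D" "y \<in> D"
    then have "x \<in> seg \<mu> y \<or> y \<in> seg \<mu> x"
      using seg_linear[of \<mu> \<eta> x y] assms \<eta> by (auto simp: D_def)
    then show "\<exists>z\<in>D. x \<in> seg \<mu> z \<and> y \<in> seg \<mu> z"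
      using xy D_T right_in_seg assms by blast
  qed
  show thesis
  proof (cases "is_supremum T (\<lambda>x y. x \<in> seg \<mu> y) D \<eta>")
    case True
    then have "D \<inter> U \<noteq> {}"
      using U directed \<open>\<eta> \<in> U\<close> unfolding scott_open_def by blast
    then obtain d where d: "d \<in> D" "d \<in> U" by blast
    then have d': "d \<in> T" "d \<noteq> \<eta>" "d \<in> seg \<mu> \<eta>"
      using seg_subset by (auto simp: D_def)
    \<comment> \<open>Since \<open>d\<close> is in \<open>seg \<mu> \<eta>\<close> but not in
      \<open>seg \<eta> x\<close>, \<open>seg_tripod\<close> puts it in \<open>seg \<mu> x\<close>;
      thus \<open>x\<close> is above \<open>d\<close>.\<close>
    have "x \<in> U" if "x \<in> component d \<eta>" for x
      using that d d' seg_tripod[of \<mu> \<eta> x] up[of d x] assms \<eta>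
      by (auto simp: component_def seg_commute)
    then show thesis
      using that[of d] d' self by auto
  next
    case False
    \<comment> \<open>\<open>\<eta>\<close> bounds \<open>D\<close>, so it fails to be the supremum
      only through an upper bound \<open>u\<close> that is not above \<open>\<eta>\<close>.\<close>
    then obtain u where u: "u \<in> T" "D \<subseteq> seg \<mu> u" "\<eta> \<notin> seg \<mu> u"
      using \<eta> by (auto simp: is_supremum_def D_def)
    obtain m where m: "m \<in> seg \<mu> \<eta>" "m \<in> seg \<mu> u" "m \<in> seg \<eta> u"
      using median_exists[of \<mu> \<eta> u] assms \<eta> u by metis
    have m': "m \<in> T" "m \<noteq> \<eta>"
      using m u seg_subset by auto
    text \<open>Here \<open>m\<close> is the immediate predecessor of \<open>\<eta>\<close> on the way from \<open>\<mu>\<close>.\<close>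
    have "x \<in> U" if "x \<in> component m \<eta>" for x
    proof -
      have x: "x \<in> T" "m \<notin> seg \<eta> x"
        using that by (auto simp: component_def)
      \<comment> \<open>The goal \<open>n = \<eta>\<close> says that \<open>x\<close> is above
        \<open>\<eta>\<close>. Otherwise \<open>n\<close> is in \<open>D\<close>, hence below
        \<open>u\<close>. If \<open>n\<close> precedes \<open>m\<close>, then \<open>m\<close> lies
        in \<open>seg \<eta> x\<close>; if \<open>m\<close> precedes \<open>n\<close>, then
        \<open>n\<close> is a second median of \<open>\<mu>, \<eta>, u\<close>, so
        \<open>n = m\<close>. Both contradict the choice of \<open>x\<close>.\<close>
      obtain n where n: "n \<in> seg \<mu> \<eta>" "n \<in> seg \<mu> x" "n \<in> seg \<eta> x"
        using median_exists[of \<mu> \<eta> x] assms \<eta> x by metis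
      have nT: "n \<in> T" using n seg_subset by auto
      have "n = \<eta>"
      proof (rule ccontr)
        assume "n \<noteq> \<eta>"
        then have nu: "n \<in> seg \<mu> u" using n u by (auto simp: D_def)
        have "m \<in> seg \<mu> n \<or> n \<in> seg \<mu> m"
          using seg_linear[of \<mu> \<eta> m n] m n assms \<eta> by auto
        moreover have False if "n \<in> seg \<mu> m"
        proof -
          have "m \<in> seg n \<eta>"
            using seg_trans(2)[of \<mu> \<eta> m n] that m assms \<eta> by auto
          then show False
            using seg_trans(1)[of \<eta> x n m] n x \<eta> nT by (auto simp: seg_commute)
        qed
        moreover have False if "m \<in> seg \<mu> n"
        proof -
          have "n \<in> seg m \<eta>"
            using seg_trans(2)[of \<mu> \<eta> n m] that n assms \<eta> by auto
          then have "n \<in> seg \<eta> u"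
            using seg_trans(1)[of \<eta> u m n] m u \<eta> m' by (auto simp: seg_commute)
          then have "m = n"
            using median_unique[of \<mu> \<eta> u m n] m n nu assms \<eta> u by auto
          then show False using n x by auto
        qed
        ultimately show False by blast
      qed
      then show ?thesis
        using up[of \<eta> x] n x assms by auto
    qed
    then show thesis
      using that[of m] m' self by auto
  qed
qed

theorem topology_of_components_eq_scott:
  assumes two: "a \<in> T" "b \<in> T" "a \<noteq> b"
  shows "topology_generated_by {component \<mu> \<nu> |\<mu> \<nu>. \<mu> \<in> T \<and> \<nu> \<in> T - {\<mu>}} =
    topology_generated_by (\<Union>\<mu>\<in>T. scott_opens T (\<lambda>x y. x \<in> seg \<mu> y))"
    (is "?W = ?S")
proof -
  have component_open: "openin ?W (component \<mu> \<nu>)" if "\<mu> \<in> T" "\<nu> \<in> T" "\<nu> \<noteq> \<mu>" for \<mu> \<nu>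
    using that by (intro topology_generated_by_Basis) blast
  have nbhd: "\<exists>V. openin ?W V \<and> \<eta> \<in> V \<and> V \<subseteq> U"
    if U: "scott_open T (\<lambda>x y. x \<in> seg \<mu> y) U" and "\<mu> \<in> T" "\<eta> \<in> U" for \<mu> U \<eta>
  proof (cases "\<eta> = \<mu>")
    case False
    then obtain d where "d \<in> T" "d \<noteq> \<eta>" "\<eta> \<in> component d \<eta>" "component d \<eta> \<subseteq> U"
      using scott_open_nbhd[OF \<open>\<mu> \<in> T\<close> U \<open>\<eta> \<in> U\<close>] by blast
    then show ?thesis
      using component_open[of d \<eta>] by (auto simp: component_def)
  next
    case True
    \<comment> \<open>A Scott open set containing its root is all of \<open>T\<close>. The second
      point ensures that the root lies in some component; a one-point tree has none.\<close>
    obtain d where "d \<in> T" "d \<noteq> \<mu>" using two by metis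
    moreover have "component d \<mu> \<subseteq> U"
    proof
      fix x assume "x \<in> component d \<mu>"
      then have "x \<in> T" by (simp add: component_def)
      then have "\<mu> \<in> seg \<mu> x" using left_in_seg \<open>\<mu> \<in> T\<close> by blast
      then show "x \<in> U"
        using U True \<open>\<eta> \<in> U\<close> \<open>x \<in> T\<close> unfolding scott_open_def by blast
    qed
    ultimately show ?thesis
      using component_open[of d \<mu>] True \<open>\<mu> \<in> T\<close>
      by (intro exI[of _ "component d \<mu>"]) (auto simp: component_def seg_self)
  qed
  have W_le_S: "openin ?S U" if "openin ?W U" for U
    using openin_topology_generated_by[OF that]
  proof (rule generate_topology_on_coarsest[rotated 2])
    show "istopology (openin ?S)" by simp
    fix V assume "V \<in> {component \<mu> \<nu> |\<mu> \<nu>. \<mu> \<in> T \<and> \<nu> \<in> T - {\<mu>}}"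
    then obtain \<mu> \<nu> where "\<mu> \<in> T" "\<nu> \<in> T" "\<nu> \<noteq> \<mu>" "V = component \<mu> \<nu>" by auto
    then show "openin ?S V"
      using component_scott_open by (intro topology_generated_by_Basis) (auto simp: scott_opens_def)
  qed
  have S_le_W: "openin ?W U" if "openin ?S U" for U
    using openin_topology_generated_by[OF that]
  proof (rule generate_topology_on_coarsest[rotated 2])
    show "istopology (openin ?W)" by simp
    fix V assume "V \<in> (\<Union>\<mu>\<in>T. scott_opens T (\<lambda>x y. x \<in> seg \<mu> y))"
    then show "openin ?W V"
      unfolding scott_opens_def by (subst openin_subopen) (use nbhd in blast)
  qed
  from W_le_S S_le_W show ?thesis unfolding topology_eq by blast
qed

end

section \<open>Valuations with values in an ordered group with infinity\<close>

instance with_inf :: (linordered_ab_group_add) ordered_ab_semigroup_add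
proof
  fix a b c :: "'a with_inf"
  show "a \<le> b \<Longrightarrow> c + a \<le> c + b"
    by (cases a; cases b; cases c) auto
qed

lemma le_Infty [simp]: "x \<le> Infty"
  by (cases x) auto

lemma Infty_le_iff [simp]: "Infty \<le> x \<longleftrightarrow> x = Infty"
  by (cases x) auto

lemma add_Infty [simp]: "x + Infty = Infty" "Infty + x = Infty"
  by (cases x; simp)+

lemma add_eq_Infty_iff [simp]: "x + y = Infty \<longleftrightarrow> x = Infty \<or> y = Infty"
  by (cases x; cases y) auto

lemma with_inf_add_less_left:
  fixes x y z :: "'l::linordered_ab_group_add with_inf"
  shows "x < y \<Longrightarrow> z \<noteq> Infty \<Longrightarrow> z + x < z + y"
  by (cases x; cases y; cases z) (auto simp: less_with_inf_def)

lemma with_inf_add_less_right: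
  fixes x y z :: "'l::linordered_ab_group_add with_inf"
  shows "x < y \<Longrightarrow> z \<noteq> Infty \<Longrightarrow> x + z < y + z"
  using with_inf_add_less_left by (simp add: add.commute)

lemma with_inf_add_min:
  fixes x y z :: "'l::linordered_ab_group_add with_inf"
  shows "x + min y z = min (x + y) (x + z)" "min y z + x = min (y + x) (z + x)"
proof -
  have "mono ((+) x)" by (simp add: mono_def add_left_mono)
  from min_of_mono[OF this, of y z]
  show "x + min y z = min (x + y) (x + z)" "min y z + x = min (y + x) (z + x)"
    by (simp_all add: add.commute)
qed

text \<open>Ordered groups are torsion-free; this gives \<open>- 1\<close> the value 0.\<close>

lemma with_inf_double_eq_0:
  fixes x :: "'l::linordered_ab_group_add with_inf"
  shows "x + x = 0 \<Longrightarrow> x = 0"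
  by (cases x) (auto simp: zero_with_inf_def)

context
  fixes \<nu> :: "'a::comm_ring_1 \<Rightarrow> 'l::linordered_ab_group_add with_inf"
  assumes \<nu>: "valuation \<nu>"
begin

lemma valuation_mult: "\<nu> (a * b) = \<nu> a + \<nu> b"
  and valuation_add: "min (\<nu> a) (\<nu> b) \<le> \<nu> (a + b)"
  and valuation_1: "\<nu> 1 = 0"
  and valuation_0: "\<nu> 0 = Infty"
  using \<nu> unfolding valuation_def by blast+

lemma valuation_minus: "\<nu> (- a) = \<nu> a"
proof -
  have "\<nu> (- 1) = 0"
    by (metis with_inf_double_eq_0 valuation_mult valuation_1 mult_minus1 minus_minus)
  then show ?thesis
    using valuation_mult[of "- 1" a] by simp
qed

end

text \<open>Stated for functions that are not yet known to be multiplicative, as it is also needed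
  in the construction of valuations.\<close>

lemma ultrametric_eq:
  fixes \<nu> :: "'a::comm_ring_1 \<Rightarrow> 'l::linordered_ab_group_add with_inf"
  assumes add: "\<And>a b. min (\<nu> a) (\<nu> b) \<le> \<nu> (a + b)" and minus: "\<And>a. \<nu> (- a) = \<nu> a"
    and less: "\<nu> a < \<nu> b"
  shows "\<nu> (a + b) = \<nu> a"
proof (rule antisym)
  have "min (\<nu> (a + b)) (\<nu> b) \<le> \<nu> a"
    using add[of "a + b" "- b"] minus by simp
  then show "\<nu> (a + b) \<le> \<nu> a"
    using less by (auto simp: min_def split: if_splits)
  show "\<nu> a \<le> \<nu> (a + b)"
    using add[of a b] less by (simp add: min_def split: if_splits)
qed

lemma valuation_add_eq:
  assumes "valuation \<nu>" "\<nu> a < \<nu> b"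
  shows "\<nu> (a + b) = \<nu> a" "\<nu> (b + a) = \<nu> a"
  using ultrametric_eq[of \<nu> a b] valuation_add[OF assms(1)] valuation_minus[OF assms(1)] assms(2)
  by (auto simp: add.commute)

lemma valuation_diff_ge:
  assumes "valuation \<nu>"
  shows "min (\<nu> a) (\<nu> b) \<le> \<nu> (a - b)"
  using valuation_add[OF assms, of a "- b"] valuation_minus[OF assms, of b] by simp

section \<open>Induction along \<phi>-adic expansions\<close>

lemma degree_div_decreases:
  fixes \<phi> :: "'k::field poly"
  assumes "0 < degree \<phi>" "f \<noteq> 0"
  shows "f div \<phi> = 0 \<or> degree (f div \<phi>) < degree f"
  using degree_div_less[of f \<phi>] div_poly_less[of f \<phi>] assms by (metis gr_zeroI)

lemma poly_div_induct [consumes 1, case_names 0 step]: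
  fixes \<phi> :: "'k::field poly"
  assumes "0 < degree \<phi>" "P 0" "\<And>f. P (f div \<phi>) \<Longrightarrow> P f"
  shows "P f"
\<comment> \<open>The measure puts 0 strictly below the nonzero constants, whose quotient is
  0.\<close>
proof (induction "if f = 0 then 0 else Suc (degree f)" arbitrary: f rule: less_induct)
  case less
  show ?case
  proof (cases "f = 0")
    case False
    have "P (f div \<phi>)"
      using less[of "f div \<phi>"] degree_div_decreases[OF assms(1) False] False by auto
    then show ?thesis by (rule assms(3))
  qed (simp add: assms(2))
qed

lemma degree_mod_less_pos: "0 < degree \<phi> \<Longrightarrow> degree (f mod \<phi>) < degree \<phi>"
  for \<phi> :: "'k::field poly"
  using degree_mod_less[of \<phi> f] by (cases "\<phi> = 0") auto

lemma valuation_div_mod_ge: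
  fixes \<phi> :: "'k::field poly"
  assumes "valuation \<nu>"
  shows "min (\<nu> (f mod \<phi>)) (\<nu> \<phi> + \<nu> (f div \<phi>)) \<le> \<nu> f"
  using valuation_add[OF assms, of "f mod \<phi>" "\<phi> * (f div \<phi>)"] valuation_mult[OF assms] by simp

section \<open>Chains of valuations\<close>

text \<open>Only a tie \<open>\<eta> r = \<eta> q\<close> at a finite value is in doubt. There
  \<open>\<mu> q\<close> exceeds \<open>\<mu> r = \<eta> r\<close>, so
  \<open>\<mu> f = \<eta> r\<close>, and \<open>\<eta> \<le> \<mu>\<close> excludes cancellation in
  \<open>\<eta> f\<close>.\<close>

lemma key_polynomial_truncation:
  fixes \<eta> \<mu> :: "'k::field poly \<Rightarrow> 'l::linordered_ab_group_add with_inf"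
  assumes \<eta>: "valuation \<eta>" and \<mu>: "valuation \<mu>" and le: "\<eta> \<le> \<mu>"
    and deg: "0 < degree \<phi>"
    and agree: "\<And>f. degree f < degree \<phi> \<Longrightarrow> \<eta> f = \<mu> f" and less: "\<eta> \<phi> < \<mu> \<phi>"
  shows "\<eta> f = min (\<eta> (f mod \<phi>)) (\<eta> \<phi> + \<eta> (f div \<phi>))"
proof -
  define r q where "r = f mod \<phi>" and "q = \<phi> * (f div \<phi>)"
  have f: "f = r + q" by (simp add: r_def q_def)
  have q: "\<eta> q = \<eta> \<phi> + \<eta> (f div \<phi>)"
    by (simp add: q_def valuation_mult[OF \<eta>])
  have "\<eta> f = min (\<eta> r) (\<eta> q)"
  proof (cases "\<eta> r = \<eta> q \<and> \<eta> q \<noteq> Infty")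
    case True
    then have "\<eta> (f div \<phi>) \<noteq> Infty" by (auto simp: q)
    then have "\<eta> \<phi> + \<eta> (f div \<phi>) < \<mu> \<phi> + \<eta> (f div \<phi>)"
      by (rule with_inf_add_less_right[OF less])
    also have "\<dots> \<le> \<mu> q"
      using le by (simp add: q_def valuation_mult[OF \<mu>] le_fun_def add_left_mono)
    moreover have "\<mu> r = \<eta> r"
      using agree[of r] deg by (simp add: r_def degree_mod_less_pos)
    ultimately have "\<mu> f = \<eta> r"
      using valuation_add_eq(1)[OF \<mu>, of r q] True f q by simp
    then have "\<eta> f \<le> \<eta> r" using le_funD[OF le, of f] by simp
    then show ?thesis
      using valuation_add[OF \<eta>, of r q] True f by simp
  next
    case False
    then consider "\<eta> r < \<eta> q" | "\<eta> q < \<eta> r" | "\<eta> r = Infty" "\<eta> q = Infty"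
      by force
    then show ?thesis
      using valuation_add_eq[OF \<eta>, of r q] valuation_add_eq[OF \<eta>, of q r]
        valuation_add[OF \<eta>, of r q] f by cases auto
  qed
  then show ?thesis by (simp add: q r_def)
qed

text \<open>By the truncation formula \<open>\<eta> f\<close> is the least value allowed by the
  values of \<open>\<eta>\<close> at \<open>\<phi>\<close> and in lower degrees, so a comparison
  there suffices.\<close>

lemma valuation_le_if_key_polynomial_le:
  fixes \<eta> \<mu> \<rho> :: "'k::field poly \<Rightarrow> 'l::linordered_ab_group_add with_inf"
  assumes \<eta>: "valuation \<eta>" and \<mu>: "valuation \<mu>" and \<rho>: "valuation \<rho>" and le: "\<eta> \<le> \<mu>"
    and deg: "0 < degree \<phi>"
    and agree: "\<And>f. degree f < degree \<phi> \<Longrightarrow> \<eta> f = \<mu> f" and less: "\<eta> \<phi> < \<mu> \<phi>"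
    and \<rho>_le: "\<And>f. degree f < degree \<phi> \<Longrightarrow> \<eta> f \<le> \<rho> f" "\<eta> \<phi> \<le> \<rho> \<phi>"
  shows "\<eta> \<le> \<rho>"
proof (rule le_funI)
  fix f show "\<eta> f \<le> \<rho> f"
    using deg
  proof (induction f rule: poly_div_induct)
    case (step f)
    have "\<eta> f = min (\<eta> (f mod \<phi>)) (\<eta> \<phi> + \<eta> (f div \<phi>))"
      by (rule key_polynomial_truncation[OF \<eta> \<mu> le deg agree less])
    also have "\<dots> \<le> min (\<rho> (f mod \<phi>)) (\<rho> \<phi> + \<rho> (f div \<phi>))"
      by (rule min.mono[OF \<rho>_le(1)[OF degree_mod_less_pos[OF deg]] add_mono[OF \<rho>_le(2) step]])
    also have "\<dots> \<le> \<rho> f"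
      by (rule valuation_div_mod_ge[OF \<rho>])
    finally show ?case .
  qed (simp add: valuation_0[OF \<rho>])
qed

lemma extensionsD:
  assumes "\<nu> \<in> extensions v"
  shows "valuation \<nu>" "degree f = 0 \<Longrightarrow> \<nu> f = v (coeff f 0)"
  using assms by (auto simp: extensions_def elim: degree_eq_zeroE)

lemma extensions_distinguishing_poly:
  assumes "\<mu> \<in> extensions v" "\<nu> \<in> extensions v" "\<mu> \<noteq> \<nu>"
  obtains \<phi> where "0 < degree \<phi>" "\<And>f. degree f < degree \<phi> \<Longrightarrow> \<mu> f = \<nu> f" "\<mu> \<phi> \<noteq> \<nu> \<phi>"
proof -
  obtain f where "\<mu> f \<noteq> \<nu> f" using assms(3) by auto
  then obtain \<phi> where \<phi>: "\<mu> \<phi> \<noteq> \<nu> \<phi>" "\<And>f. degree f < degree \<phi> \<Longrightarrow> \<mu> f = \<nu> f"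
    using ex_has_least_nat[of "\<lambda>f. \<mu> f \<noteq> \<nu> f" f degree] not_le by metis
  \<comment> \<open>On constants both extensions equal \<open>v\<close>.\<close>
  moreover have "0 < degree \<phi>"
    using \<phi>(1) extensionsD(2)[OF assms(1), of \<phi>] extensionsD(2)[OF assms(2), of \<phi>] by fastforce
  ultimately show thesis using that by blast
qed

theorem extensions_chain:
  assumes \<eta>: "\<eta> \<in> extensions v" and \<rho>: "\<rho> \<in> extensions v" and \<mu>: "\<mu> \<in> extensions v"
    and le: "\<eta> \<le> \<mu>" "\<rho> \<le> \<mu>"
  shows "\<eta> \<le> \<rho> \<or> \<rho> \<le> \<eta>"
proof (cases "\<eta> = \<mu> \<or> \<rho> = \<mu>")
  case False
  \<comment> \<open>The roles are symmetric. The polynomial \<open>\<phi>\<close> of smaller degree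
    decides, since \<open>\<alpha>\<close> and \<open>\<beta>\<close> both agree with
    \<open>\<mu>\<close> below its degree.\<close>
  have *: "\<alpha> \<le> \<beta> \<or> \<beta> \<le> \<alpha>"
    if \<alpha>: "valuation \<alpha>" "\<alpha> \<le> \<mu>" "0 < degree \<phi>" "\<And>f. degree f < degree \<phi> \<Longrightarrow> \<alpha> f = \<mu> f" "\<alpha> \<phi> \<noteq> \<mu> \<phi>"
      and \<beta>: "valuation \<beta>" "\<beta> \<le> \<mu>" "0 < degree \<psi>" "\<And>f. degree f < degree \<psi> \<Longrightarrow> \<beta> f = \<mu> f" "\<beta> \<psi> \<noteq> \<mu> \<psi>"
      and deg: "degree \<phi> \<le> degree \<psi>" for \<alpha> \<beta> \<phi> \<psi>
  proof (cases "\<alpha> \<phi> \<le> \<beta> \<phi>")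
    case True
    have "\<alpha> \<phi> < \<mu> \<phi>" using \<alpha> by (simp add: le_fun_def order.not_eq_order_implies_strict)
    then have "\<alpha> \<le> \<beta>"
      using \<alpha> \<beta> deg True extensionsD(1)[OF \<mu>]
      by (intro valuation_le_if_key_polynomial_le[of \<alpha> \<mu> \<beta> \<phi>]) auto
    then show ?thesis ..
  next
    case False
    \<comment> \<open>Here \<open>\<phi>\<close> turns out to separate \<open>\<beta>\<close> from
      \<open>\<mu>\<close> as well, again in minimal degree.\<close>
    then have "\<beta> \<phi> < \<alpha> \<phi>" by simp
    also have "\<dots> \<le> \<mu> \<phi>" using \<alpha> by (simp add: le_fun_def)
    finally have "\<beta> \<le> \<alpha>"
      using \<alpha> \<beta> deg False extensionsD(1)[OF \<mu>]
      by (intro valuation_le_if_key_polynomial_le[of \<beta> \<mu> \<alpha> \<phi>]) auto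
    then show ?thesis ..
  qed
  obtain \<phi> where \<phi>: "0 < degree \<phi>" "\<And>f. degree f < degree \<phi> \<Longrightarrow> \<eta> f = \<mu> f" "\<eta> \<phi> \<noteq> \<mu> \<phi>"
    using extensions_distinguishing_poly[OF \<eta> \<mu>] False by metis
  obtain \<psi> where \<psi>: "0 < degree \<psi>" "\<And>f. degree f < degree \<psi> \<Longrightarrow> \<rho> f = \<mu> f" "\<rho> \<psi> \<noteq> \<mu> \<psi>"
    using extensions_distinguishing_poly[OF \<rho> \<mu>] False by metis
  show ?thesis
    using *[OF extensionsD(1)[OF \<eta>] le(1) \<phi> extensionsD(1)[OF \<rho>] le(2) \<psi>]
      *[OF extensionsD(1)[OF \<rho>] le(2) \<psi> extensionsD(1)[OF \<eta>] le(1) \<phi>]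
    by linarith
qed (use le in auto)

section \<open>Infima of valuations\<close>

text \<open>\<open>\<mu>\<close> and \<open>\<nu>\<close> need not be comparable;
  \<open>\<mu>\<close> is merely the one that is smaller at \<open>\<phi>\<close>, a polynomial of
  least degree on which they differ.\<close>

locale branching =
  fixes \<mu> \<nu> :: "'k::field poly \<Rightarrow> 'l::linordered_ab_group_add with_inf" and \<phi> :: "'k poly"
  assumes val_\<mu>: "valuation \<mu>" and val_\<nu>: "valuation \<nu>"
    and deg_pos: "0 < degree \<phi>"
    and agree: "\<And>f. degree f < degree \<phi> \<Longrightarrow> \<mu> f = \<nu> f"
    and less: "\<mu> \<phi> < \<nu> \<phi>"
begin

text \<open>The candidate for the infimum: the truncation of \<open>\<mu>\<close> at
  \<open>\<phi>\<close>, with the expansion read off by repeated division.\<close>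

function trunc :: "'k poly \<Rightarrow> 'l with_inf" where
  "trunc f = (if f = 0 then Infty else min (\<mu> (f mod \<phi>)) (\<mu> \<phi> + trunc (f div \<phi>)))"
  by auto
termination
proof (relation "Wellfounded.measure (\<lambda>f. if f = 0 then 0 else Suc (degree f))")
  fix f :: "'k poly" assume "f \<noteq> 0"
  then show "(f div \<phi>, f) \<in> Wellfounded.measure (\<lambda>f. if f = 0 then 0 else Suc (degree f))"
    using degree_div_decreases[OF deg_pos] by auto
qed simp

declare trunc.simps [simp del]

lemma trunc_0 [simp]: "trunc 0 = Infty"
  by (simp add: trunc.simps)

text \<open>At 0 both terms are \<open>Infty\<close>, so the case split made for termination
  disappears.\<close>

lemma trunc_rec: "trunc f = min (\<mu> (f mod \<phi>)) (\<mu> \<phi> + trunc (f div \<phi>))"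
  by (cases "f = 0") (simp_all add: trunc.simps[of f] valuation_0[OF val_\<mu>])

lemma trunc_low: "degree f < degree \<phi> \<Longrightarrow> trunc f = \<mu> f"
  by (simp add: trunc_rec[of f] mod_poly_less div_poly_less min_def)

lemma trunc_mod: "trunc (f mod \<phi>) = \<mu> (f mod \<phi>)"
  by (simp add: trunc_low degree_mod_less_pos deg_pos)

lemma trunc_add_ge: "min (trunc f) (trunc g) \<le> trunc (f + g)"
  using deg_pos
proof (induction f arbitrary: g rule: poly_div_induct)
  case (step f)
  have "min (trunc f) (trunc g) \<le>
    min (min (\<mu> (f mod \<phi>)) (\<mu> (g mod \<phi>)))
      (\<mu> \<phi> + min (trunc (f div \<phi>)) (trunc (g div \<phi>)))"
    unfolding trunc_rec[of f] trunc_rec[of g] with_inf_add_min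
    by (simp add: min.assoc min.commute min.left_commute)
  also have "\<dots> \<le> min (\<mu> ((f + g) mod \<phi>)) (\<mu> \<phi> + trunc ((f + g) div \<phi>))"
    using valuation_add[OF val_\<mu>] step
    by (intro min.mono add_left_mono) (simp_all add: poly_mod_add_left poly_div_add_left)
  finally show ?case by (simp add: trunc_rec[of "f + g"])
qed simp

lemma trunc_mult_key: "trunc (\<phi> * f) = \<mu> \<phi> + trunc f"
  using deg_pos by (auto simp: trunc_rec[of "\<phi> * f"] valuation_0[OF val_\<mu>] min_def)

lemma trunc_le_1: "trunc \<le> \<mu>" and trunc_le_2: "trunc \<le> \<nu>"
proof -
  have "trunc f \<le> \<mu> f \<and> trunc f \<le> \<nu> f" for f
    using deg_pos
  proof (induction f rule: poly_div_induct)
    case (step f)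
    have "trunc f \<le> min (\<mu> (f mod \<phi>)) (\<mu> \<phi> + \<mu> (f div \<phi>))"
      unfolding trunc_rec[of f] using step by (intro min.mono add_left_mono) auto
    also have "\<dots> \<le> \<mu> f" by (rule valuation_div_mod_ge[OF val_\<mu>])
    finally have "trunc f \<le> \<mu> f" .
    have "trunc f \<le> min (\<nu> (f mod \<phi>)) (\<nu> \<phi> + \<nu> (f div \<phi>))"
      unfolding trunc_rec[of f] using step less
      by (intro min.mono add_mono) (auto simp: agree degree_mod_less_pos deg_pos)
    also have "\<dots> \<le> \<nu> f" by (rule valuation_div_mod_ge[OF val_\<nu>])
    finally show ?case using \<open>trunc f \<le> \<mu> f\<close> by simp
  qed (simp add: valuation_0[OF val_\<mu>] valuation_0[OF val_\<nu>])
  then show "trunc \<le> \<mu>" "trunc \<le> \<nu>" by (auto simp: le_fun_def)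
qed

text \<open>\<open>\<nu>\<close> excludes cancellation. A failure would force
  \<open>\<mu> r = \<mu> (\<phi> * q) < \<mu> c\<close> in \<open>c = r + \<phi> * q\<close>. Then
  \<open>\<nu>\<close> exceeds \<open>\<mu> r\<close> on both \<open>c\<close> and
  \<open>\<phi> * q\<close>, hence on \<open>r\<close>, where \<open>\<mu>\<close> and
  \<open>\<nu>\<close> agree.\<close>

lemma trunc_mult_low_low:
  assumes "degree a < degree \<phi>" "degree b < degree \<phi>"
  shows "\<mu> a + \<mu> b \<le> trunc (a * b)"
proof (rule ccontr)
  define c r q where "c = a * b" and "r = c mod \<phi>" and "q = c div \<phi>"
  assume "\<not> \<mu> a + \<mu> b \<le> trunc (a * b)"
  then have *: "trunc c < \<mu> c" by (simp add: c_def valuation_mult[OF val_\<mu>])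
  have \<mu>\<nu>: "\<mu> c = \<nu> c"
    using assms by (simp add: c_def valuation_mult[OF val_\<mu>] valuation_mult[OF val_\<nu>] agree)
  have c: "r = c - \<phi> * q" by (simp add: r_def q_def minus_mult_div_eq_mod)
  have r: "degree r < degree \<phi>" by (simp add: r_def degree_mod_less_pos deg_pos)
  \<comment> \<open>As \<open>c\<close> has degree below \<open>2 * degree \<phi>\<close>, its
    expansion has at most two terms; so \<open>\<mu>\<close>, \<open>\<nu>\<close> and
    \<open>trunc\<close> agree on \<open>q\<close>.\<close>
  have q: "degree q < degree \<phi>"
  proof (cases "q = 0")
    case False
    then have "degree \<phi> + degree q = degree (c - r)"
      using deg_pos by (subst degree_mult_eq[symmetric]) (auto simp: c)
    also have "\<dots> \<le> max (degree c) (degree r)" by (rule degree_diff_le_max)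
    also have "\<dots> < degree \<phi> + degree \<phi>"
      using degree_mult_le[of a b] assms r by (simp add: c_def)
    finally show ?thesis by simp
  qed (use deg_pos in simp)
  have trunc_c: "trunc c = min (\<mu> r) (\<mu> \<phi> + \<mu> q)"
    using trunc_low[OF q] by (simp add: trunc_rec[of c] r_def q_def)
  have \<phi>q: "\<mu> (\<phi> * q) = \<mu> \<phi> + \<mu> q" by (simp add: valuation_mult[OF val_\<mu>])
  show False
  proof (cases "\<mu> c \<le> \<mu> \<phi> + \<mu> q")
    case True
    then have "\<mu> c \<le> \<mu> r"
      using valuation_diff_ge[OF val_\<mu>, of c "\<phi> * q"] by (simp add: c \<phi>q)
    then have "\<mu> c \<le> trunc c" using True trunc_c by simp
    then show False using * by simp
  next
    case False
    then have lt: "\<mu> (- (\<phi> * q)) < \<mu> c" by (simp add: valuation_minus[OF val_\<mu>] \<phi>q)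
    have \<mu>r: "\<mu> r = \<mu> \<phi> + \<mu> q"
      using valuation_add_eq(1)[OF val_\<mu> lt] by (simp add: c valuation_minus[OF val_\<mu>] \<phi>q)
    have "\<mu> q \<noteq> Infty" using False by auto
    then have "\<mu> r < \<nu> (\<phi> * q)"
      using with_inf_add_less_right[OF less, of "\<mu> q"] q \<mu>r
      by (simp add: valuation_mult[OF val_\<nu>] agree)
    moreover have "\<mu> r < \<nu> c" using False \<mu>r \<mu>\<nu> by simp
    ultimately have "\<mu> r < \<nu> r"
      using valuation_diff_ge[OF val_\<nu>, of c "\<phi> * q"]
      unfolding c[symmetric] by (meson less_le_trans min_less_iff_conj)
    then show False using agree[OF r] by simp
  qed
qed

text \<open>Applies \<open>trunc_mult_low_low\<close> to each coefficient in the expansion of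
  \<open>g\<close>; \<open>trunc_mult_ge\<close> then expands the other factor.\<close>

lemma trunc_mult_low:
  assumes "degree a < degree \<phi>"
  shows "\<mu> a + trunc g \<le> trunc (a * g)"
  using deg_pos
proof (induction g rule: poly_div_induct)
  case (step g)
  have "\<mu> a + trunc g = min (\<mu> a + \<mu> (g mod \<phi>)) (\<mu> \<phi> + (\<mu> a + trunc (g div \<phi>)))"
    by (simp add: trunc_rec[of g] with_inf_add_min add.left_commute)
  also have "\<dots> \<le> min (trunc (a * (g mod \<phi>))) (trunc (\<phi> * (a * (g div \<phi>))))"
    unfolding trunc_mult_key using step
    by (intro min.mono add_left_mono trunc_mult_low_low degree_mod_less_pos deg_pos assms)
  also have "\<dots> \<le> trunc (a * (g mod \<phi>) + \<phi> * (a * (g div \<phi>)))"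
    by (rule trunc_add_ge)
  also have "a * (g mod \<phi>) + \<phi> * (a * (g div \<phi>)) = a * (g mod \<phi> + \<phi> * (g div \<phi>))"
    by (simp only: algebra_simps)
  finally show ?case by simp
qed simp

lemma trunc_mult_ge: "trunc f + trunc g \<le> trunc (f * g)"
  using deg_pos
proof (induction f rule: poly_div_induct)
  case (step f)
  have "trunc f + trunc g = min (\<mu> (f mod \<phi>) + trunc g) (\<mu> \<phi> + (trunc (f div \<phi>) + trunc g))"
    by (simp add: trunc_rec[of f] with_inf_add_min add.assoc)
  also have "\<dots> \<le> min (trunc ((f mod \<phi>) * g)) (trunc (\<phi> * (f div \<phi> * g)))"
    unfolding trunc_mult_key using step
    by (intro min.mono add_left_mono trunc_mult_low degree_mod_less_pos deg_pos)
  also have "\<dots> \<le> trunc ((f mod \<phi>) * g + \<phi> * (f div \<phi> * g))"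
    by (rule trunc_add_ge)
  also have "(f mod \<phi>) * g + \<phi> * (f div \<phi> * g) = (f mod \<phi> + \<phi> * (f div \<phi>)) * g"
    by (simp only: algebra_simps)
  finally show ?case by simp
qed simp

lemma trunc_minus: "trunc (- f) = trunc f"
proof -
  have "trunc f \<le> trunc (- f)" for f
    using trunc_mult_low[of "- 1" f] deg_pos
    by (simp add: valuation_minus[OF val_\<mu>] valuation_1[OF val_\<mu>])
  from this[of f] this[of "- f"] show ?thesis by simp
qed

text \<open>As \<open>\<nu> \<phi>\<close> exceeds \<open>\<mu> \<phi>\<close>, \<open>\<nu>\<close> sees only the constant term of the \<open>\<phi>\<close>-expansion
  of \<open>f\<close> when this term has minimal value. This is how \<open>\<nu>\<close> bounds \<open>trunc\<close> from above.\<close>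

lemma le_trunc_if_constant_term_dominates:
  assumes "\<mu> (f mod \<phi>) \<le> \<mu> \<phi> + trunc (f div \<phi>)"
  shows "\<nu> f \<le> trunc f"
proof (cases "\<mu> (f mod \<phi>) = Infty")
  case True
  then show ?thesis using assms by (simp add: trunc_rec[of f])
next
  case False
  have mod: "\<nu> (f mod \<phi>) = \<mu> (f mod \<phi>)"
    by (simp add: agree degree_mod_less_pos deg_pos)
  have "\<mu> (f mod \<phi>) < \<nu> \<phi> + trunc (f div \<phi>)"
  \<comment> \<open>Adding \<open>Infty\<close> to \<open>\<mu> \<phi> < \<nu> \<phi>\<close> would
    lose strictness; in that case the left side being finite is enough.\<close>
  proof (cases "trunc (f div \<phi>) = Infty")
    case True
    then show ?thesis using False by (simp add: order.not_eq_order_implies_strict)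
  next
    case False
    then show ?thesis
      using assms with_inf_add_less_right[OF less] le_less_trans by blast
  qed
  also have "\<dots> \<le> \<nu> (\<phi> * (f div \<phi>))"
    using trunc_le_2 by (simp add: valuation_mult[OF val_\<nu>] le_fun_def add_left_mono)
  finally have "\<nu> (f mod \<phi> + \<phi> * (f div \<phi>)) = \<nu> (f mod \<phi>)"
    by (intro valuation_add_eq(1)[OF val_\<nu>]) (simp add: mod)
  then show ?thesis using assms by (simp add: trunc_rec[of f] mod)
qed

text \<open>If the constant term of \<open>f\<close> does not attain the minimum, the part of
  \<open>f * g\<close> divisible by \<open>\<phi>\<close> has strictly smaller value than the rest
  and determines the result.\<close>

lemma trunc_mult_step:
  assumes nondom: "\<mu> \<phi> + trunc (f div \<phi>) < \<mu> (f mod \<phi>)"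
    and IH: "trunc (f div \<phi> * g) = trunc (f div \<phi>) + trunc g"
  shows "trunc (f * g) = trunc f + trunc g"
proof (cases "trunc g = Infty")
  case True
  then show ?thesis using trunc_mult_ge[of f g] by simp
next
  case False
  have eq: "f * g = \<phi> * (f div \<phi> * g) + (f mod \<phi>) * g"
    using mult_div_mod_eq[of \<phi> f] by (metis distrib_right mult.assoc)
  have "trunc (\<phi> * (f div \<phi> * g)) = \<mu> \<phi> + trunc (f div \<phi>) + trunc g"
    by (simp add: trunc_mult_key IH add.assoc)
  moreover have "\<mu> \<phi> + trunc (f div \<phi>) + trunc g < \<mu> (f mod \<phi>) + trunc g"
    by (rule with_inf_add_less_right[OF nondom False])
  moreover have "\<mu> (f mod \<phi>) + trunc g \<le> trunc ((f mod \<phi>) * g)"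
    by (intro trunc_mult_low degree_mod_less_pos deg_pos)
  ultimately have "trunc (f * g) = \<mu> \<phi> + trunc (f div \<phi>) + trunc g"
    unfolding eq by (subst ultrametric_eq[of trunc, OF trunc_add_ge trunc_minus]) auto
  moreover have "trunc f = \<mu> \<phi> + trunc (f div \<phi>)"
    unfolding trunc_rec[of f] using nondom by (intro min_absorb2) simp
  ultimately show ?thesis by simp
qed

text \<open>A factor whose constant term does not attain the minimum is reduced to its quotient. If
  both constant terms attain it, \<open>\<nu>\<close> is at most \<open>trunc\<close> on
  \<open>f\<close> and \<open>g\<close>, and multiplicativity of \<open>\<nu>\<close> with
  \<open>trunc \<le> \<nu>\<close> gives the missing inequality.\<close>

lemma trunc_mult: "trunc (f * g) = trunc f + trunc g"
  using deg_pos
proof (induction f rule: poly_div_induct)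
  case (step f)
  show ?case
  proof (cases "\<mu> (f mod \<phi>) \<le> \<mu> \<phi> + trunc (f div \<phi>)")
    case False
    then show ?thesis using trunc_mult_step[OF _ step] by simp
  next
    case dom_f: True
    show ?thesis
      using deg_pos
    proof (induction g rule: poly_div_induct)
      case (step g)
      show ?case
      proof (cases "\<mu> (g mod \<phi>) \<le> \<mu> \<phi> + trunc (g div \<phi>)")
        case False
        then show ?thesis
          using trunc_mult_step[of g f] step by (metis not_le mult.commute add.commute)
      next
        case True
        have "trunc (f * g) \<le> \<nu> f + \<nu> g"
          using trunc_le_2 by (simp add: le_fun_def flip: valuation_mult[OF val_\<nu>])
        also have "\<dots> \<le> trunc f + trunc g"
          using dom_f True by (intro add_mono le_trunc_if_constant_term_dominates)
        finally show ?thesis using trunc_mult_ge by (simp add: antisym)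
      qed
    qed simp
  qed
qed simp

lemma valuation_trunc: "valuation trunc"
  unfolding valuation_def
  using trunc_mult trunc_add_ge trunc_low[of 1] valuation_1[OF val_\<mu>] deg_pos by simp

text \<open>Assuming \<open>trunc \<le> \<rho>\<close> costs nothing for the infimum, because
  \<open>\<rho>\<close> and \<open>trunc\<close> lie below \<open>\<mu>\<close> and are comparable
  by \<open>extensions_chain\<close>. It bounds \<open>\<rho> (f mod \<phi>)\<close> from below, so
  that a strictly smaller quotient part determines \<open>\<rho> f\<close>.\<close>

lemma le_trunc:
  assumes \<rho>: "valuation \<rho>" and le: "\<rho> \<le> \<mu>" "\<rho> \<le> \<nu>" and ge: "trunc \<le> \<rho>"
  shows "\<rho> \<le> trunc"
proof (rule le_funI)
  fix f show "\<rho> f \<le> trunc f"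
    using deg_pos
  proof (induction f rule: poly_div_induct)
    case (step f)
    show ?case
    proof (cases "\<mu> (f mod \<phi>) \<le> \<mu> \<phi> + trunc (f div \<phi>)")
      case True
      then show ?thesis
        using le_trunc_if_constant_term_dominates le_funD[OF le(2)] order_trans by blast
    next
      case False
      have "\<rho> (\<phi> * (f div \<phi>)) \<le> \<mu> \<phi> + trunc (f div \<phi>)"
        using step le_funD[OF le(1)] by (simp add: valuation_mult[OF \<rho>] add_mono)
      moreover have "\<mu> (f mod \<phi>) \<le> \<rho> (f mod \<phi>)"
        using le_funD[OF ge, of "f mod \<phi>"] by (simp add: trunc_mod)
      ultimately have "\<rho> (\<phi> * (f div \<phi>) + f mod \<phi>) = \<rho> (\<phi> * (f div \<phi>))"
        using False by (intro valuation_add_eq(1)[OF \<rho>]) auto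
      then show ?thesis
        using \<open>\<rho> (\<phi> * (f div \<phi>)) \<le> _\<close> False by (simp add: trunc_rec[of f])
    qed
  qed simp
qed

end

section \<open>Existence of the infimum of two extensions\<close>

lemma isGlb_pair_iff:
  "isGlb S {a, b} c \<longleftrightarrow> c \<in> S \<and> c \<le> a \<and> c \<le> b \<and> (\<forall>x\<in>S. x \<le> a \<and> x \<le> b \<longrightarrow> x \<le> c)"
  by (auto simp: isGlb_def greatestP_def isLb_def setge_def setle_def)

lemma extensions_isGlb_exists:
  assumes \<mu>: "\<mu> \<in> extensions v" and \<nu>: "\<nu> \<in> extensions v"
  shows "\<exists>\<eta>. isGlb (extensions v) {\<mu>, \<nu>} \<eta>"
proof -
  \<comment> \<open>By symmetry, the valuation that is smaller at \<open>\<phi>\<close> may be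
    called \<open>\<mu>\<close>.\<close>
  have *: "\<exists>\<eta>. isGlb (extensions v) {\<mu>, \<nu>} \<eta>"
    if \<mu>: "\<mu> \<in> extensions v" and \<nu>: "\<nu> \<in> extensions v"
      and \<phi>: "0 < degree \<phi>" "\<And>f. degree f < degree \<phi> \<Longrightarrow> \<mu> f = \<nu> f" "\<mu> \<phi> < \<nu> \<phi>" for \<mu> \<nu> \<phi>
  proof -
    interpret branching \<mu> \<nu> \<phi>
      using that extensionsD(1) by unfold_locales blast+
    have ext: "trunc \<in> extensions v"
      using \<mu> deg_pos by (auto simp: extensions_def valuation_trunc trunc_low)
    show ?thesis
      unfolding isGlb_pair_iff
    proof (intro exI conjI ballI impI)
      fix \<rho> assume \<rho>: "\<rho> \<in> extensions v" "\<rho> \<le> \<mu> \<and> \<rho> \<le> \<nu>"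
      then have "\<rho> \<le> trunc \<or> trunc \<le> \<rho>"
        using extensions_chain[OF \<rho>(1) ext \<mu>] trunc_le_1 by blast
      then show "\<rho> \<le> trunc"
        using le_trunc extensionsD(1)[OF \<rho>(1)] \<rho>(2) by blast
    qed (rule ext trunc_le_1 trunc_le_2)+
  qed
  show ?thesis
  proof (cases "\<mu> = \<nu>")
    case True
    then show ?thesis using \<mu> isGlb_pair_iff[of "extensions v" \<mu> \<nu> \<mu>] by auto
  next
    case False
    then obtain \<phi> where \<phi>: "0 < degree \<phi>" "\<And>f. degree f < degree \<phi> \<Longrightarrow> \<mu> f = \<nu> f" "\<mu> \<phi> \<noteq> \<nu> \<phi>"
      using extensions_distinguishing_poly[OF \<mu> \<nu>] by metis
    show ?thesis
    proof (cases "\<mu> \<phi> < \<nu> \<phi>")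
      case True
      then show ?thesis using *[OF \<mu> \<nu> \<phi>(1,2)] by simp
    next
      case False
      then show ?thesis
        using *[OF \<nu> \<mu> \<phi>(1)] \<phi>(2,3) by (simp add: insert_commute)
    qed
  qed
qed

lemma val_meet_isGlb:
  assumes "\<mu> \<in> extensions v" "\<nu> \<in> extensions v"
  shows "isGlb (extensions v) {\<mu>, \<nu>} (val_meet v \<mu> \<nu>)"
proof -
  obtain \<eta> where \<eta>: "isGlb (extensions v) {\<mu>, \<nu>} \<eta>"
    using extensions_isGlb_exists[OF assms] by blast
  moreover have "\<eta>' = \<eta>" if "isGlb (extensions v) {\<mu>, \<nu>} \<eta>'" for \<eta>'
    using that \<eta> by (intro antisym) (simp_all add: isGlb_pair_iff)
  ultimately show ?thesis
    unfolding val_meet_def by (rule theI[where P = "isGlb (extensions v) {\<mu>, \<nu>}"])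
qed

text \<open>Evaluation at points of the field supplies the two distinct extensions that the
  comparison of topologies requires.\<close>

lemma evaluation_extension:
  fixes c :: "'k::field"
  assumes "valuation v"
  shows "(\<lambda>f. v (poly f c)) \<in> extensions v"
  using valuation_mult[OF assms] valuation_add[OF assms] valuation_0[OF assms] valuation_1[OF assms]
  by (simp add: extensions_def valuation_def)

section \<open>The tree of extensions\<close>

interpretation extensions: meet_tree "extensions v" "val_meet v"
  for v :: "'k::field \<Rightarrow> 'l::linordered_ab_group_add with_inf"
proof
  fix a b c assume ab: "a \<in> extensions v" "b \<in> extensions v"
  note glb = val_meet_isGlb[OF ab, unfolded isGlb_pair_iff]
  show "val_meet v a b \<in> extensions v" "val_meet v a b \<le> a" "val_meet v a b \<le> b"
    using glb by blast+
  show "c \<le> val_meet v a b" if "c \<in> extensions v" "c \<le> a" "c \<le> b"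
    using glb that by blast
  show "a \<le> b \<or> b \<le> a" if "c \<in> extensions v" "a \<le> c" "b \<le> c"
    using extensions_chain ab that by blast
qed

theorem mainTheorem1:
  fixes v :: "'k::field \<Rightarrow> 'l::linordered_ab_group_add with_inf"
  assumes valued_field: "valuation v"
    and contains_hull: "\<exists>H. is_divisible_hull (value_group v) H"
    and densely_ordered: "\<forall>\<gamma> \<delta> :: 'l. \<gamma> < \<delta> \<longrightarrow> (\<exists>\<alpha>. \<gamma> < \<alpha> \<and> \<alpha> < \<delta>)"
  shows "weak_tree_topology v =
    topology_generated_by (\<Union>\<mu>\<in>extensions v. scott_opens (extensions v) (rooted_le v \<mu>))"
proof -
  \<comment> \<open>The polynomial x takes the value \<open>Infty\<close> through the point 0 and
    the value 0 through the point 1.\<close>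
  have "v (poly [:0, 1:] 0) \<noteq> v (poly [:0, 1:] 1)"
    using valuation_0[OF valued_field] valuation_1[OF valued_field] by (simp add: zero_with_inf_def)
  then have "(\<lambda>f. v (poly f 0)) \<noteq> (\<lambda>f. v (poly f 1))" by metis
  moreover have seg: "interval v = extensions.seg v"
    by (intro ext) (simp add: interval_def extensions.seg_def)
  ultimately show ?thesis
    using extensions.topology_of_components_eq_scott[OF
        evaluation_extension[OF valued_field, of 0] evaluation_extension[OF valued_field, of 1]]
    by (simp add: weak_tree_topology_def tree_class_def rooted_le_def[abs_def]
        extensions.component_def)
qed

end
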